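(* There is no randomized online algorithm for the discrete setting of the restricted data-center model that achieves a competitive ratio $c<2$ (against an oblivious adversary).
   Context: Restricted model: given $m\in\mathbb{N}$, $\beta>0$, a non-negative convex function $f:[0,1]\to\mathbb{R}_{\ge0}$ (known in advance) and loads $\lambda_1,\dots,\lambda_T\ge0$, find $X=(x_1,\dots,x_T)$ with $x_t\in\{0,\dots,m\}$ (discrete setting) and $x_t\ge\lambda_t$ minimizing $\sum_{t=1}^T x_tf(\lambda_t/x_t)+\beta\sum_{t=1}^T(x_t-x_{t-1})^+$ with $x_0=0$, $(y)^+=\max(0,y)$. Online: $\lambda_t$ is revealed at time $t$ and $x_t$ is chosen then, irrevocably, possibly using randomness. A randomized online algorithm has competitive ratio $c$ against an oblivious adversary if for every instance (fixed in advance, independently of the random choices) its expected cost is at most $c$ times the optimal offline cost. *)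

theory Defs
  imports "HOL-Probability.Probability"
begin

text \<open>
  Time is shifted by one: load and number of active servers at time \<open>t\<close> (for \<open>t = 1, ..., T\<close>)
  are \<open>ls ! (t - 1)\<close> and \<open>xs ! (t - 1)\<close>, where \<open>T = length ls\<close>.
\<close>

definition restricted_model :: "real \<Rightarrow> (real \<Rightarrow> real) \<Rightarrow> bool" where
  "restricted_model \<beta> f \<longleftrightarrow> \<beta> > 0 \<and> convex_on {0..1} f \<and> (\<forall>z\<in>{0..1}. f z \<ge> 0)"

text \<open>The upper bound \<open>m\<close> on the loads says that a feasible schedule exists.\<close>

definition load_sequence :: "nat \<Rightarrow> real list \<Rightarrow> bool" where
  "load_sequence m ls \<longleftrightarrow> (\<forall>l\<in>set ls. 0 \<le> l \<and> l \<le> real m)"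

definition feasible :: "nat \<Rightarrow> real list \<Rightarrow> nat list \<Rightarrow> bool" where
  "feasible m ls xs \<longleftrightarrow>
     length xs = length ls \<and> (\<forall>t<length ls. xs ! t \<le> m \<and> ls ! t \<le> real (xs ! t))"

text \<open>
  The previous state of \<open>xs ! t\<close> is \<open>(0 # xs) ! t\<close>, since the initial state is \<open>0\<close>.
  In a feasible schedule \<open>xs ! t = 0\<close> only if the load is \<open>0\<close>; the operating cost is then \<open>0\<close>.
\<close>

definition schedule_cost :: "real \<Rightarrow> (real \<Rightarrow> real) \<Rightarrow> real list \<Rightarrow> nat list \<Rightarrow> real" where
  "schedule_cost \<beta> f ls xs =
     (\<Sum>t<length ls. real (xs ! t) * f (ls ! t / real (xs ! t)))
     + \<beta> * (\<Sum>t<length ls. max 0 (real (xs ! t) - real ((0 # xs) ! t)))"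

definition opt_cost :: "nat \<Rightarrow> real \<Rightarrow> (real \<Rightarrow> real) \<Rightarrow> real list \<Rightarrow> real" where
  "opt_cost m \<beta> f ls = (INF xs\<in>{xs. feasible m ls xs}. schedule_cost \<beta> f ls xs)"

text \<open>
  A deterministic online algorithm maps the loads revealed up to and including the current time
  to the number of servers used at that time; in particular it does not know \<open>T\<close>.
\<close>

definition online_schedule :: "(real list \<Rightarrow> nat) \<Rightarrow> real list \<Rightarrow> nat list" where
  "online_schedule a ls = map (\<lambda>t. a (take (Suc t) ls)) [0..<length ls]"

text \<open>
  A randomized online algorithm is a random deterministic one: for the parameters \<open>m\<close>, \<open>\<beta>\<close>, \<open>f\<close>,
  which are known in advance, \<open>M m \<beta> f\<close> is the probability space of its random choices and
  \<open>A m \<beta> f \<omega>\<close> is the deterministic online algorithm that it runs on the outcome \<open>\<omega>\<close>.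
\<close>

definition randomized_online_algorithm ::
  "(nat \<Rightarrow> real \<Rightarrow> (real \<Rightarrow> real) \<Rightarrow> 'w measure) \<Rightarrow>
   (nat \<Rightarrow> real \<Rightarrow> (real \<Rightarrow> real) \<Rightarrow> 'w \<Rightarrow> real list \<Rightarrow> nat) \<Rightarrow> bool" where
  "randomized_online_algorithm M A \<longleftrightarrow>
     (\<forall>m \<beta> f. restricted_model \<beta> f \<longrightarrow>
        prob_space (M m \<beta> f) \<and>
        (\<forall>ls. load_sequence m ls \<and> ls \<noteq> [] \<longrightarrow>
           (\<lambda>\<omega>. A m \<beta> f \<omega> ls) \<in> measurable (M m \<beta> f) (count_space UNIV)) \<and>
        (\<forall>ls. load_sequence m ls \<longrightarrow>
           (AE \<omega> in M m \<beta> f. feasible m ls (online_schedule (A m \<beta> f \<omega>) ls))))"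

text \<open>
  The cost of a randomized online algorithm takes almost surely only finitely many values,
  so it is integrable and the integral below is its expectation.
\<close>

definition competitive_oblivious ::
  "(nat \<Rightarrow> real \<Rightarrow> (real \<Rightarrow> real) \<Rightarrow> 'w measure) \<Rightarrow>
   (nat \<Rightarrow> real \<Rightarrow> (real \<Rightarrow> real) \<Rightarrow> 'w \<Rightarrow> real list \<Rightarrow> nat) \<Rightarrow> real \<Rightarrow> bool" where
  "competitive_oblivious M A c \<longleftrightarrow>
     (\<forall>m \<beta> f ls. restricted_model \<beta> f \<and> load_sequence m ls \<longrightarrow>
        (LINT \<omega>|M m \<beta> f. schedule_cost \<beta> f ls (online_schedule (A m \<beta> f \<omega>) ls))
          \<le> c * opt_cost m \<beta> f ls)"

end

theory Submission imports Defs begin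

text \<open>
  With \<open>m = 2\<close>, \<open>\<beta> = 1\<close> and \<open>f z = e * \<bar>1 - 2 * z\<bar>\<close>, a load of \<open>1/2\<close> charges \<open>e\<close> to the schedules in
  state \<open>2\<close> and a load of \<open>1\<close> charges \<open>e\<close> to those in state \<open>1\<close>; each forbids state \<open>0\<close>. Let \<open>p\<close> be
  the probability that the algorithm is in state \<open>2\<close>, let \<open>V\<close> be the optimal cost of reaching
  state \<open>1\<close> and \<open>V + 1 - y\<close> that of reaching state \<open>2\<close>. The adversary compares \<open>p\<close> with \<open>y\<close>:
  it charges state \<open>2\<close> if \<open>p\<close> is the larger one, which lowers \<open>y\<close> by \<open>e\<close>, and state \<open>1\<close> otherwise,
  which raises \<open>y\<close> and \<open>V\<close> by \<open>e\<close>. An algorithm that tracks \<open>y\<close> pays \<open>e * y\<close> on the way down and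
  \<open>e * (1 - y) + e\<close> on the way up, so that \<open>y\<^sup>2 / 2\<close> amortizes its cost to twice the increase of \<open>V\<close>,
  and lagging behind is charged by \<open>max 0 (y - p)\<close>.
\<close>

section \<open>Schedules extended by one load, and bounds on the optimal cost\<close>

lemma schedule_cost_snoc:
  assumes "length xs = length ls"
  shows "schedule_cost \<beta> f (ls @ [l]) (xs @ [x]) =
    schedule_cost \<beta> f ls xs + real x * f (l / real x) + \<beta> * max 0 (real x - real (last (0 # xs)))"
proof -
  have "(\<Sum>t<length ls. real ((xs @ [x]) ! t) * f ((ls @ [l]) ! t / real ((xs @ [x]) ! t))) =
      (\<Sum>t<length ls. real (xs ! t) * f (ls ! t / real (xs ! t)))"
    using assms by (intro sum.cong) (auto simp: nth_append)
  moreover have "(\<Sum>t<length ls. max 0 (real ((xs @ [x]) ! t) - real ((0 # xs @ [x]) ! t))) =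
      (\<Sum>t<length ls. max 0 (real (xs ! t) - real ((0 # xs) ! t)))"
    using assms by (intro sum.cong) (auto simp: nth_append nth_Cons split: nat.splits)
  moreover have "(0 # xs @ [x]) ! length ls = last (0 # xs)"
    using assms by (cases xs rule: rev_cases) (auto simp: nth_append nth_Cons split: nat.splits)
  ultimately show ?thesis
    using assms by (simp add: schedule_cost_def algebra_simps nth_append)
qed

lemma schedule_cost_nonneg:
  assumes "\<beta> \<ge> 0" "\<And>z. f z \<ge> 0"
  shows "schedule_cost \<beta> f ls xs \<ge> 0"
  unfolding schedule_cost_def using assms
  by (intro add_nonneg_nonneg mult_nonneg_nonneg sum_nonneg) auto

lemma opt_cost_le:
  assumes "\<beta> \<ge> 0" "\<And>z. f z \<ge> 0" "feasible m ls xs"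
  shows "opt_cost m \<beta> f ls \<le> schedule_cost \<beta> f ls xs"
  unfolding opt_cost_def using assms schedule_cost_nonneg[OF assms(1,2)]
  by (intro cINF_lower bdd_belowI2[of _ 0]) auto

lemma opt_cost_nonneg:
  assumes "\<beta> \<ge> 0" "\<And>z. f z \<ge> 0" "feasible m ls xs"
  shows "opt_cost m \<beta> f ls \<ge> 0"
  unfolding opt_cost_def using assms schedule_cost_nonneg[OF assms(1,2)]
  by (intro cINF_greatest) auto

lemma feasible_snoc:
  "feasible m ls xs \<Longrightarrow> x \<le> m \<Longrightarrow> l \<le> real x \<Longrightarrow> feasible m (ls @ [l]) (xs @ [x])"
  by (auto simp: feasible_def nth_append less_Suc_eq)

lemma feasible_last_le:
  assumes "feasible m ls xs" "ls \<noteq> []"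
  shows "last ls \<le> real (last xs)" "last xs \<le> m"
proof -
  have "length xs = length ls" "xs \<noteq> []" "length ls - 1 < length ls"
    using assms by (auto simp: feasible_def)
  then show "last ls \<le> real (last xs)" "last xs \<le> m"
    using assms by (auto simp: feasible_def last_conv_nth)
qed

lemma length_online_schedule [simp]: "length (online_schedule a ls) = length ls"
  by (simp add: online_schedule_def)

lemma online_schedule_snoc:
  "online_schedule a (ls @ [l]) = online_schedule a ls @ [a (ls @ [l])]"
  by (simp add: online_schedule_def)

lemma online_schedule_eq_Nil [simp]: "online_schedule a ls = [] \<longleftrightarrow> ls = []"
  by (simp add: online_schedule_def)

lemma last_online_schedule: "ls \<noteq> [] \<Longrightarrow> last (online_schedule a ls) = a ls"
  by (cases ls rule: rev_cases) (auto simp: online_schedule_snoc)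

section \<open>The operating cost function of the hard instances\<close>

definition vee :: "real \<Rightarrow> real \<Rightarrow> real" where
  "vee e z = e * \<bar>1 - 2 * z\<bar>"

lemma vee_nonneg: "e \<ge> 0 \<Longrightarrow> vee e z \<ge> 0"
  by (simp add: vee_def)

lemma convex_on_vee:
  assumes "e \<ge> 0"
  shows "convex_on {0..1} (vee e)"
proof (rule convex_onI)
  fix t x y :: real
  assume t: "0 < t" "t < 1"
  have "\<bar>1 - 2 * ((1 - t) * x + t * y)\<bar> = \<bar>(1 - t) * (1 - 2 * x) + t * (1 - 2 * y)\<bar>"
    by (simp add: algebra_simps)
  also have "\<dots> \<le> (1 - t) * \<bar>1 - 2 * x\<bar> + t * \<bar>1 - 2 * y\<bar>"
    using t abs_triangle_ineq[of "(1 - t) * (1 - 2 * x)" "t * (1 - 2 * y)"] by (simp add: abs_mult)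
  finally have "e * \<bar>1 - 2 * ((1 - t) * x + t * y)\<bar> \<le> e * ((1 - t) * \<bar>1 - 2 * x\<bar> + t * \<bar>1 - 2 * y\<bar>)"
    using assms by (intro mult_left_mono) auto
  then show "vee e ((1 - t) *\<^sub>R x + t *\<^sub>R y) \<le> (1 - t) * vee e x + t * vee e y"
    by (simp add: vee_def algebra_simps)
qed auto

text \<open>Multiplying by \<open>x\<close> clears the quotient: load \<open>l\<close> charges the
  distance of the state from \<open>2 * l\<close>, so that \<open>1 / 2\<close> is free in state 1
  and \<open>1\<close> is free in state 2.\<close>

lemma operating_cost_vee:
  assumes "x \<ge> 1"
  shows "real x * vee e (l / real x) = e * \<bar>real x - 2 * l\<bar>"
proof -
  have "real x * \<bar>1 - 2 * (l / real x)\<bar> = \<bar>real x * (1 - 2 * (l / real x))\<bar>"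
    by (simp add: abs_mult)
  also have "real x * (1 - 2 * (l / real x)) = real x - 2 * l"
    using assms by (simp add: field_simps)
  finally show ?thesis by (simp add: vee_def algebra_simps)
qed

lemma schedule_cost_vee_snoc:
  assumes "length xs = length ls" "xs \<noteq> []" "x \<ge> 1"
  shows "schedule_cost 1 (vee e) (ls @ [l]) (xs @ [x]) =
    schedule_cost 1 (vee e) ls xs + e * \<bar>real x - 2 * l\<bar> + max 0 (real x - real (last xs))"
  using assms by (simp add: schedule_cost_snoc operating_cost_vee)

section \<open>Amortization by a potential function\<close>

text \<open>
  The terms of order \<open>e\<close> make every move of the algorithm cost at least \<open>e\<close> times its length, hence
  the operating cost may be charged at the position before the move.
\<close>

definition potential :: "real \<Rightarrow> real \<Rightarrow> real \<Rightarrow> real" where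
  "potential e p y = y\<^sup>2 / 2 + (1 - 2 * e) * max 0 (y - p) - e * p"

text \<open>Moving up by \<open>d\<close> lowers the lag term by at most
  \<open>(1 - 2 * e) * d\<close> and \<open>- e * p\<close> by \<open>e * d\<close>. Together with
  the claimed \<open>e * d\<close> this is exactly the switching cost \<open>d\<close>, whence the
  factor \<open>1 - 2 * e\<close>. On a move down by \<open>d\<close> the lag term does not shrink
  and \<open>- e * p\<close> yields \<open>e * d\<close>.\<close>

lemma potential_move:
  assumes "0 < e" "e \<le> 1 / 2"
  shows "potential e p y + e * \<bar>q - p\<bar> \<le> potential e q y + max 0 (q - p)"
proof (cases "p \<le> q")
  case True
  have "(1 - 2 * e) * max 0 (y - p) \<le> (1 - 2 * e) * (max 0 (y - q) + (q - p))"
    using assms True by (intro mult_left_mono) auto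
  then show ?thesis using True by (simp add: potential_def algebra_simps)
next
  case False
  have "(1 - 2 * e) * max 0 (y - p) \<le> (1 - 2 * e) * max 0 (y - q)"
    using assms False by (intro mult_left_mono) auto
  then show ?thesis using False by (simp add: potential_def algebra_simps)
qed

text \<open>
  Comparing \<open>p\<close> with \<open>y\<close> itself would get stuck at the ends of the interval: an algorithm resting
  at \<open>p = y = 1\<close> would be charged nothing. The threshold is therefore shifted inwards there.
\<close>

definition threshold :: "real \<Rightarrow> real \<Rightarrow> real" where
  "threshold e y = e\<^sup>2 / 8 + (1 - e\<^sup>2 / 4) * y"

lemma threshold_bounds:
  assumes "0 \<le> y" "y \<le> 1"
  shows "y - e\<^sup>2 / 8 \<le> threshold e y" "threshold e y \<le> y + e\<^sup>2 / 8"
proof -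
  have "0 \<le> e\<^sup>2 * (1 - y)" "0 \<le> e\<^sup>2 * y" using assms by auto
  then show "y - e\<^sup>2 / 8 \<le> threshold e y" "threshold e y \<le> y + e\<^sup>2 / 8"
    by (auto simp: threshold_def algebra_simps)
qed

lemma cube_le_square: "0 < e \<Longrightarrow> e \<le> 1 / 2 \<Longrightarrow> e ^ 3 \<le> (e::real)\<^sup>2"
  by (rule power_decreasing) auto

text \<open>The charge \<open>e * p\<close> matches the linear loss \<open>e * y\<close> of the
  square up to \<open>e ^ 3 / 8\<close>. The second-order term \<open>e\<^sup>2 / 2\<close> absorbs
  this error and the old lag, at most \<open>e\<^sup>2 / 8\<close>, and leaves the gain.\<close>

lemma potential_down:
  assumes e: "0 < e" "e \<le> 1 / 2" and y: "e \<le> y" "y \<le> 1" and p: "threshold e y \<le> p"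
  shows "potential e p y + e ^ 3 / 8 \<le> potential e p (y - e) + e * p"
proof -
  have p': "y - e\<^sup>2 / 8 \<le> p" using threshold_bounds(1)[of y e] e y p by auto
  have "max 0 (y - p) \<le> e\<^sup>2 / 8" using p' by (auto simp: max_def)
  then have "(1 - 2 * e) * max 0 (y - p) \<le> 1 * (e\<^sup>2 / 8)"
    using e by (intro mult_mono) auto
  moreover have "0 \<le> (1 - 2 * e) * max 0 (y - e - p)" using e by simp
  moreover have "e * (y - e\<^sup>2 / 8) \<le> e * p" using e p' by (intro mult_left_mono) auto
  moreover have "e * (y - e\<^sup>2 / 8) = e * y - e ^ 3 / 8"
    by (simp add: right_diff_distrib power3_eq_cube power2_eq_square)
  moreover have "(y - e)\<^sup>2 / 2 = y\<^sup>2 / 2 - e * y + e\<^sup>2 / 2"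
    by (simp add: power2_diff field_simps)
  ultimately show ?thesis
    using cube_le_square[OF e] zero_le_power2[of e] unfolding potential_def by linarith
qed

text \<open>Here \<open>(2 - 2 * e) * e\<close> pays for \<open>V\<close> growing by
  \<open>e\<close>. The charge and the linear gain of the square give about \<open>e\<close>; the
  lag term gives about \<open>(1 - 2 * e) * e\<close>, because \<open>p\<close> hardly exceeds
  \<open>y\<close>.\<close>

lemma potential_up:
  assumes e: "0 < e" "e \<le> 1 / 2" and y: "0 \<le> y" "y \<le> 1" and p: "p \<le> threshold e y"
  shows "potential e p y + (2 - 2 * e) * e + e ^ 3 / 8 \<le> potential e p (y + e) + e * (1 - p)"
proof -
  have p': "p \<le> y + e\<^sup>2 / 8" using threshold_bounds(2)[of y e] y p by auto
  have cube: "e * e\<^sup>2 = e ^ 3" "e * e = e\<^sup>2"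
    by (auto simp: power3_eq_cube power2_eq_square)
  have "(1 - 2 * e) * (max 0 (y - p) + (e - e\<^sup>2 / 8)) \<le> (1 - 2 * e) * max 0 (y + e - p)"
    using e p' by (intro mult_left_mono) (auto simp: max_def)
  moreover have "(1 - 2 * e) * (max 0 (y - p) + (e - e\<^sup>2 / 8)) =
      (1 - 2 * e) * max 0 (y - p) + e - e\<^sup>2 / 8 - 2 * e\<^sup>2 + e ^ 3 / 4"
    by (simp add: field_simps power2_eq_square power3_eq_cube)
  moreover have "e * p \<le> e * (y + e\<^sup>2 / 8)" using e p' by (intro mult_left_mono) auto
  moreover have "e * (y + e\<^sup>2 / 8) = e * y + e ^ 3 / 8" "(2 - 2 * e) * e = 2 * e - 2 * e\<^sup>2"
    "e * (1 - p) = e - e * p"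
    using cube by (simp_all add: algebra_simps)
  moreover have "(y + e)\<^sup>2 / 2 = y\<^sup>2 / 2 + e * y + e\<^sup>2 / 2"
    by (simp add: power2_sum field_simps)
  moreover have "0 < e ^ 3" using e by simp
  ultimately show ?thesis
    using zero_le_power2[of e] unfolding potential_def by linarith
qed

section \<open>The algorithm at fixed parameters and its expected cost\<close>

locale two_state_algorithm = prob_space M for M :: "'w measure" +
  fixes a :: "'w \<Rightarrow> real list \<Rightarrow> nat" and e :: real
  assumes e_pos: "0 < e" and e_le: "e \<le> 1 / 2"
    and meas: "load_sequence 2 ls \<Longrightarrow> ls \<noteq> [] \<Longrightarrow> (\<lambda>\<omega>. a \<omega> ls) \<in> measurable M (count_space UNIV)"
    and feas: "load_sequence 2 ls \<Longrightarrow> AE \<omega> in M. feasible 2 ls (online_schedule (a \<omega>) ls)"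
begin

abbreviation cost :: "real list \<Rightarrow> 'w \<Rightarrow> real" where
  "cost ls \<omega> \<equiv> schedule_cost 1 (vee e) ls (online_schedule (a \<omega>) ls)"

definition loads :: "real list \<Rightarrow> bool" where
  "loads ls \<longleftrightarrow> set ls \<subseteq> {1 / 2, 1}"

text \<open>Almost surely the state is \<open>1\<close> or \<open>2\<close>, so this is the probability of state \<open>2\<close>.\<close>

definition P :: "real list \<Rightarrow> real" where
  "P ls = expectation (\<lambda>\<omega>. real (a \<omega> ls)) - 1"

lemma loads_load_sequence: "loads ls \<Longrightarrow> load_sequence 2 ls"
  by (auto simp: loads_def load_sequence_def)

lemma loads_snoc: "loads (ls @ [l]) \<longleftrightarrow> loads ls \<and> (l = 1 / 2 \<or> l = 1)"
  by (auto simp: loads_def)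

lemma AE_states:
  assumes "loads ls" "ls \<noteq> []"
  shows "AE \<omega> in M. 1 \<le> a \<omega> ls \<and> a \<omega> ls \<le> 2"
  using feas[OF loads_load_sequence[OF assms(1)]]
proof eventually_elim
  case (elim \<omega>)
  \<comment> \<open>Both loads are positive, which rules out state 0.\<close>
  have "last ls \<in> {1 / 2, 1}" using assms last_in_set[of ls] unfolding loads_def by blast
  then show ?case using feasible_last_le[OF elim assms(2)] assms(2)
    by (auto simp: last_online_schedule)
qed

lemma measurable_state:
  assumes "loads ls" "ls \<noteq> []"
  shows "(\<lambda>\<omega>. real (a \<omega> ls)) \<in> borel_measurable M"
  using measurable_compose[OF meas[OF loads_load_sequence[OF assms(1)] assms(2)], of real borel]
  by simp

lemma integrable_state:
  assumes "loads ls" "ls \<noteq> []"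
  shows "integrable M (\<lambda>\<omega>. real (a \<omega> ls))"
  using AE_states[OF assms] measurable_state[OF assms]
  by (intro integrable_const_bound[of _ 2]) auto

lemma P_bounds:
  assumes "loads ls" "ls \<noteq> []"
  shows "0 \<le> P ls" "P ls \<le> 1"
proof -
  have "expectation (\<lambda>\<omega>. real (a \<omega> ls)) \<le> 2" "expectation (\<lambda>\<omega>. real (a \<omega> ls)) \<ge> 1"
    using AE_states[OF assms] integrable_state[OF assms]
    by (auto intro!: integral_le_const integral_ge_const)
  then show "0 \<le> P ls" "P ls \<le> 1" by (auto simp: P_def)
qed

lemma AE_cost_snoc:
  assumes "loads (ls @ [l])"
  shows "AE \<omega> in M. cost (ls @ [l]) \<omega> = cost ls \<omega> + e * \<bar>real (a \<omega> (ls @ [l])) - 2 * l\<bar>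
    + max 0 (real (a \<omega> (ls @ [l])) - (if ls = [] then 0 else real (a \<omega> ls)))"
proof -
  have "ls @ [l] \<noteq> []" by simp
  from AE_states[OF assms this] show ?thesis
    by eventually_elim
      (auto simp: online_schedule_snoc schedule_cost_snoc operating_cost_vee last_online_schedule)
qed

lemma integrable_cost:
  assumes "loads ls"
  shows "integrable M (cost ls)"
  using assms
proof (induction ls rule: rev_induct)
  case Nil
  then show ?case by (simp add: schedule_cost_def)
next
  case (snoc l ls)
  let ?x = "\<lambda>\<omega>. real (a \<omega> (ls @ [l]))"
  have ne: "ls @ [l] \<noteq> []" by simp
  have [measurable]: "?x \<in> borel_measurable M"
    using measurable_state[OF snoc.prems] by simp
  have x: "integrable M ?x" using integrable_state[OF snoc.prems] by simp
  have y: "integrable M (\<lambda>\<omega>. real (last (0 # online_schedule (a \<omega>) ls)))"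
  proof (cases "ls = []")
    case True
    then show ?thesis by (simp add: online_schedule_def)
  next
    case False
    then show ?thesis using snoc.prems integrable_state[of ls]
      by (simp add: last_online_schedule loads_snoc)
  qed
  \<comment> \<open>The closed form needs a positive state, so the operating cost is bounded only
    almost surely.\<close>
  have "integrable M (\<lambda>\<omega>. ?x \<omega> * vee e (l / ?x \<omega>))"
  proof (rule integrable_const_bound)
    show "AE \<omega> in M. norm (?x \<omega> * vee e (l / ?x \<omega>)) \<le> e * 2"
      using AE_states[OF snoc.prems ne]
    proof eventually_elim
      case (elim \<omega>)
      then have "e * \<bar>?x \<omega> - 2 * l\<bar> \<le> e * 2"
        using snoc.prems e_pos by (intro mult_left_mono) (auto simp: loads_snoc)
      then show ?case using elim e_pos by (simp add: operating_cost_vee)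
    qed
    show "(\<lambda>\<omega>. ?x \<omega> * vee e (l / ?x \<omega>)) \<in> borel_measurable M"
      unfolding vee_def by measurable
  qed
  then show ?case
    using snoc x y by (auto simp: online_schedule_snoc schedule_cost_snoc loads_snoc
        intro!: Bochner_Integration.integrable_add integrable_max Bochner_Integration.integrable_diff)
qed

text \<open>Jensen's inequality: absolute value and positive part are convex, so randomization costs
  at least as much as following the mean state \<open>P ls + 1\<close> deterministically.\<close>

lemma expected_cost_snoc:
  assumes l: "loads (ls @ [l])" and ls: "ls \<noteq> []"
  shows "expectation (cost ls) + e * \<bar>P (ls @ [l]) + 1 - 2 * l\<bar> + max 0 (P (ls @ [l]) - P ls)
    \<le> expectation (cost (ls @ [l]))"
proof -
  let ?x = "\<lambda>\<omega>. real (a \<omega> (ls @ [l]))" and ?y = "\<lambda>\<omega>. real (a \<omega> ls)"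
  have ls': "loads ls" using l by (simp add: loads_snoc)
  have x: "integrable M ?x" using integrable_state[OF l] by simp
  have y: "integrable M ?y" using integrable_state[OF ls' ls] .
  have c: "integrable M (cost ls)" using integrable_cost[OF ls'] .
  have ix: "integrable M (\<lambda>\<omega>. \<bar>?x \<omega> - 2 * l\<bar>)" using x by auto
  have im: "integrable M (\<lambda>\<omega>. max 0 (?x \<omega> - ?y \<omega>))" using x y by (intro integrable_max) auto
  have "\<bar>P (ls @ [l]) + 1 - 2 * l\<bar> = \<bar>expectation (\<lambda>\<omega>. ?x \<omega> - 2 * l)\<bar>"
    using x by (simp add: P_def prob_space)
  also have "\<dots> \<le> expectation (\<lambda>\<omega>. \<bar>?x \<omega> - 2 * l\<bar>)"
    by (rule integral_abs_bound)
  finally have 1: "e * \<bar>P (ls @ [l]) + 1 - 2 * l\<bar> \<le> e * expectation (\<lambda>\<omega>. \<bar>?x \<omega> - 2 * l\<bar>)"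
    using e_pos by simp
  have "P (ls @ [l]) - P ls = expectation (\<lambda>\<omega>. ?x \<omega> - ?y \<omega>)"
    using x y by (simp add: P_def)
  also have "\<dots> \<le> expectation (\<lambda>\<omega>. max 0 (?x \<omega> - ?y \<omega>))"
    using x y im by (intro integral_mono) auto
  finally have 2: "max 0 (P (ls @ [l]) - P ls) \<le> expectation (\<lambda>\<omega>. max 0 (?x \<omega> - ?y \<omega>))"
    by simp
  have "expectation (cost (ls @ [l])) =
      expectation (\<lambda>\<omega>. cost ls \<omega> + e * \<bar>?x \<omega> - 2 * l\<bar> + max 0 (?x \<omega> - ?y \<omega>))"
    using AE_cost_snoc[OF l] ls c ix im integrable_cost[OF l]
    by (intro integral_cong_AE) auto
  also have "\<dots> = expectation (cost ls) + e * expectation (\<lambda>\<omega>. \<bar>?x \<omega> - 2 * l\<bar>)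
      + expectation (\<lambda>\<omega>. max 0 (?x \<omega> - ?y \<omega>))"
    using c ix im by simp
  finally show ?thesis using 1 2 by linarith
qed

section \<open>Offline schedules against the two loads\<close>

text \<open>
  \<open>V\<close> and \<open>V + 1 - y\<close> bound the costs of reaching states \<open>1\<close> and \<open>2\<close> when the state may still
  change once after the last load: lowering it is free, raising it is the summand \<open>2 - last xs\<close>.
\<close>

definition offline_bound :: "real list \<Rightarrow> real \<Rightarrow> real \<Rightarrow> bool" where
  "offline_bound ls V y \<longleftrightarrow>
     (\<exists>xs. feasible 2 ls xs \<and> schedule_cost 1 (vee e) ls xs \<le> V) \<and>
     (\<exists>xs. feasible 2 ls xs \<and>
        schedule_cost 1 (vee e) ls xs + (2 - real (last xs)) \<le> V + 1 - y)"

lemma feasible_loads_last: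
  assumes "feasible 2 ls xs" "loads ls" "ls \<noteq> []"
  shows "xs \<noteq> []" "length xs = length ls" "1 \<le> last xs" "last xs \<le> 2"
proof -
  have "last ls \<in> {1 / 2, 1}" using assms last_in_set[of ls] unfolding loads_def by blast
  then show "1 \<le> last xs" "last xs \<le> 2" using feasible_last_le[OF assms(1,3)] by auto
qed (use assms in \<open>auto simp: feasible_def\<close>)

text \<open>The first schedule drops to state 1 for free. The second keeps its state for at most
  \<open>e\<close>, or, once \<open>y \<le> e\<close>, is replaced by the first one plus a final
  raise, which keeps \<open>y\<close> nonnegative.\<close>

lemma offline_bound_down:
  assumes "offline_bound ls V y" "loads ls" "ls \<noteq> []"
  shows "offline_bound (ls @ [1 / 2]) V (max 0 (y - e))"
proof -
  obtain xs xs' where xs: "feasible 2 ls xs" "schedule_cost 1 (vee e) ls xs \<le> V"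
    and xs': "feasible 2 ls xs'" "schedule_cost 1 (vee e) ls xs' + (2 - real (last xs')) \<le> V + 1 - y"
    using assms(1) by (auto simp: offline_bound_def)
  note f = feasible_loads_last[OF xs(1) assms(2,3)] and f' = feasible_loads_last[OF xs'(1) assms(2,3)]
  have 1: "feasible 2 (ls @ [1 / 2]) (xs @ [1])"
    "schedule_cost 1 (vee e) (ls @ [1 / 2]) (xs @ [1]) \<le> V"
    using xs f by (auto intro!: feasible_snoc simp: schedule_cost_vee_snoc)
  have "e * \<bar>real (last xs') - 1\<bar> \<le> e * 1"
    using f' e_pos by (intro mult_left_mono) auto
  then have 2: "feasible 2 (ls @ [1 / 2]) (xs' @ [last xs'])"
    "schedule_cost 1 (vee e) (ls @ [1 / 2]) (xs' @ [last xs']) + (2 - real (last xs')) \<le> V + 1 - (y - e)"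
    using xs' f' by (auto intro!: feasible_snoc simp: schedule_cost_vee_snoc)
  let ?xs' = "if y \<le> e then xs @ [1] else xs' @ [last xs']"
  show ?thesis
    unfolding offline_bound_def
  proof (intro conjI exI)
    show "feasible 2 (ls @ [1 / 2]) (xs @ [1])" "schedule_cost 1 (vee e) (ls @ [1 / 2]) (xs @ [1]) \<le> V"
      using 1 by auto
    show "feasible 2 (ls @ [1 / 2]) ?xs'" using 1 2 by simp
    show "schedule_cost 1 (vee e) (ls @ [1 / 2]) ?xs' + (2 - real (last ?xs')) \<le> V + 1 - max 0 (y - e)"
      using 1 2 by (cases "y \<le> e") auto
  qed
qed

text \<open>The first schedule keeps its state for at most \<open>e\<close>; the second goes to
  state 2, a raise that its bound already includes. If \<open>y = 1\<close>, the second costs at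
  most \<open>V\<close> and serves for both.\<close>

lemma offline_bound_up:
  assumes "offline_bound ls V y" "loads ls" "ls \<noteq> []"
  shows "offline_bound (ls @ [1]) (V + e) (y + e)" "y = 1 \<Longrightarrow> offline_bound (ls @ [1]) V 1"
proof -
  obtain xs xs' where xs: "feasible 2 ls xs" "schedule_cost 1 (vee e) ls xs \<le> V"
    and xs': "feasible 2 ls xs'" "schedule_cost 1 (vee e) ls xs' + (2 - real (last xs')) \<le> V + 1 - y"
    using assms(1) by (auto simp: offline_bound_def)
  note f = feasible_loads_last[OF xs(1) assms(2,3)] and f' = feasible_loads_last[OF xs'(1) assms(2,3)]
  have "e * \<bar>real (last xs) - 2\<bar> \<le> e * 1"
    using f e_pos by (intro mult_left_mono) auto
  then have 1: "feasible 2 (ls @ [1]) (xs @ [last xs])"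
    "schedule_cost 1 (vee e) (ls @ [1]) (xs @ [last xs]) \<le> V + e"
    using xs f by (auto intro!: feasible_snoc simp: schedule_cost_vee_snoc)
  have 2: "feasible 2 (ls @ [1]) (xs' @ [2])"
    "schedule_cost 1 (vee e) (ls @ [1]) (xs' @ [2]) \<le> V + 1 - y"
    using xs' f' by (auto intro!: feasible_snoc simp: schedule_cost_vee_snoc)
  show "offline_bound (ls @ [1]) (V + e) (y + e)"
    unfolding offline_bound_def
  proof
    show "\<exists>xs. feasible 2 (ls @ [1]) xs \<and> schedule_cost 1 (vee e) (ls @ [1]) xs \<le> V + e"
      using 1 by blast
  qed (use 2 in \<open>auto intro!: exI[of _ "xs' @ [2]"]\<close>)
  show "y = 1 \<Longrightarrow> offline_bound (ls @ [1]) V 1"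
    using 2 unfolding offline_bound_def by (auto intro!: exI[of _ "xs' @ [2]"])
qed

section \<open>The adversary and its gain per load\<close>

lemma expected_cost_potential_down:
  assumes "loads ls" "ls \<noteq> []"
  shows "expectation (cost ls) + potential e (P ls) y + e * P ls
    \<le> expectation (cost (ls @ [1 / 2])) + potential e (P (ls @ [1 / 2])) y"
proof -
  let ?p = "P ls" and ?q = "P (ls @ [1 / 2])"
  have q: "loads (ls @ [1 / 2])" using assms by (simp add: loads_snoc)
  \<comment> \<open>The triangle inequality moves the operating cost from \<open>?q\<close> back to
    \<open>?p\<close>; \<open>potential_move\<close> supplies
    \<open>e * \<bar>?q - ?p\<bar>\<close>. As \<open>y\<close> is arbitrary, it may be the updated
    value.\<close>
  have "e * ?p \<le> e * (\<bar>?q\<bar> + \<bar>?q - ?p\<bar>)" using e_pos by (intro mult_left_mono) auto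
  then show ?thesis
    using expected_cost_snoc[OF q assms(2)] potential_move[OF e_pos e_le, of ?p y ?q]
    by (simp add: algebra_simps)
qed

lemma expected_cost_potential_up:
  assumes "loads ls" "ls \<noteq> []"
  shows "expectation (cost ls) + potential e (P ls) y + e * (1 - P ls)
    \<le> expectation (cost (ls @ [1])) + potential e (P (ls @ [1])) y"
proof -
  let ?p = "P ls" and ?q = "P (ls @ [1])"
  have q: "loads (ls @ [1])" using assms by (simp add: loads_snoc)
  have "e * (1 - ?p) \<le> e * (\<bar>?q - 1\<bar> + \<bar>?q - ?p\<bar>)" using e_pos by (intro mult_left_mono) auto
  then show ?thesis
    using expected_cost_snoc[OF q assms(2)] potential_move[OF e_pos e_le, of ?p y ?q]
    by (simp add: algebra_simps)
qed

text \<open>Each round gains \<open>e ^ 3 / 8\<close> over the ratio \<open>2 - 2 * e\<close>. The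
  grid of multiples of \<open>1 / N\<close> lets \<open>y\<close> hit both 0 and 1 exactly.\<close>

lemma adversary:
  assumes N: "e = 1 / real N" "N > 0"
  shows "\<exists>ls k V. loads ls \<and> ls \<noteq> [] \<and> k \<le> N \<and> offline_bound ls V (real k * e) \<and>
    expectation (cost ls) + potential e (P ls) (real k * e) \<ge> (2 - 2 * e) * V + real n * (e ^ 3 / 8) - 3"
proof (induction n)
  \<comment> \<open>Serving one load in state 1 costs the first power-up, so \<open>V = 1\<close>;
    the constant 3 covers \<open>2 - 2 * e\<close> and the initial potential, at least
    \<open>- e\<close>.\<close>
  case 0
  have l: "loads [1 / 2]" by (simp add: loads_def)
  have "offline_bound [1 / 2] 1 0"
    unfolding offline_bound_def
    by (intro conjI exI[of _ "[1]"]) (auto simp: feasible_def schedule_cost_def vee_def)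
  moreover have "0 \<le> expectation (cost [1 / 2])"
    using e_pos by (intro integral_nonneg_AE AE_I2 schedule_cost_nonneg vee_nonneg) auto
  moreover have "- e \<le> potential e (P [1 / 2]) 0"
    using P_bounds[OF l] e_pos by (simp add: potential_def)
  ultimately show ?case using l e_pos
    by (intro exI[of _ "[1 / 2]"] exI[of _ 0] exI[of _ 1]) auto
next
  case (Suc n)
  then obtain ls k V where ls: "loads ls" "ls \<noteq> []" and k: "k \<le> N"
    and off: "offline_bound ls V (real k * e)"
    and cost: "expectation (cost ls) + potential e (P ls) (real k * e)
      \<ge> (2 - 2 * e) * V + real n * (e ^ 3 / 8) - 3"
    by blast
  let ?y = "real k * e"
  have y: "0 \<le> ?y" "?y \<le> 1" using k N by auto
  have cube: "e * e\<^sup>2 = e ^ 3" by (simp add: power3_eq_cube power2_eq_square)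
  show ?case
  proof (cases "threshold e ?y \<le> P ls")
    case down: True
    have l: "loads (ls @ [1 / 2])" using ls by (simp add: loads_snoc)
    note step = expected_cost_potential_down[OF ls]
    show ?thesis
    proof (cases k)
      case 0
      \<comment> \<open>At the ends of the interval neither \<open>V\<close> nor \<open>y\<close>
        changes; the shifted threshold alone provides the gain.\<close>
      have "e * (e\<^sup>2 / 8) \<le> e * P ls"
        using down 0 e_pos by (intro mult_left_mono) (auto simp: threshold_def)
      then have "(2 - 2 * e) * V + real (Suc n) * (e ^ 3 / 8) - 3
          \<le> expectation (cost (ls @ [1 / 2])) + potential e (P (ls @ [1 / 2])) (real 0 * e)"
        using cost step[of "real 0 * e"] cube unfolding 0 of_nat_Suc distrib_right by linarith
      moreover have "offline_bound (ls @ [1 / 2]) V (real 0 * e)"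
        using offline_bound_down[OF off ls] 0 e_pos by simp
      ultimately show ?thesis using l by blast
    next
      case (Suc j)
      then have j: "?y = real j * e + e" by (simp add: algebra_simps)
      have le: "e \<le> ?y" using j e_pos by simp
      have pot: "potential e (P ls) ?y + e ^ 3 / 8 \<le> potential e (P ls) (real j * e) + e * P ls"
        using potential_down[OF e_pos e_le le y(2) down] j by simp
      have "offline_bound (ls @ [1 / 2]) V (real j * e)"
        using offline_bound_down[OF off ls] j e_pos by simp
      moreover have "(2 - 2 * e) * V + real (Suc n) * (e ^ 3 / 8) - 3
          \<le> expectation (cost (ls @ [1 / 2])) + potential e (P (ls @ [1 / 2])) (real j * e)"
        using cost step[of "real j * e"] pot unfolding of_nat_Suc distrib_right by linarith
      moreover have "j \<le> N" using k Suc by simp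
      ultimately show ?thesis using l by blast
    qed
  next
    case up: False
    have l: "loads (ls @ [1])" using ls by (simp add: loads_snoc)
    note step = expected_cost_potential_up[OF ls]
    show ?thesis
    proof (cases "k = N")
      case True
      then have y1: "?y = 1" using N by simp
      have "e * (e\<^sup>2 / 8) \<le> e * (1 - P ls)"
        using up y1 e_pos by (intro mult_left_mono) (auto simp: threshold_def)
      then have "(2 - 2 * e) * V + real (Suc n) * (e ^ 3 / 8) - 3
          \<le> expectation (cost (ls @ [1])) + potential e (P (ls @ [1])) ?y"
        using cost step[of ?y] cube unfolding of_nat_Suc distrib_right by linarith
      moreover have "offline_bound (ls @ [1]) V ?y"
        using offline_bound_up(2)[OF off ls] y1 by simp
      ultimately show ?thesis using l k by blast
    next
      case False
      have j: "real (Suc k) * e = ?y + e" by (simp add: algebra_simps)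
      have "potential e (P ls) ?y + (2 - 2 * e) * e + e ^ 3 / 8
          \<le> potential e (P ls) (?y + e) + e * (1 - P ls)"
        using potential_up[OF e_pos e_le y] up by simp
      then have "(2 - 2 * e) * (V + e) + real (Suc n) * (e ^ 3 / 8) - 3
          \<le> expectation (cost (ls @ [1])) + potential e (P (ls @ [1])) (?y + e)"
        using cost step[of "?y + e"] unfolding of_nat_Suc distrib_left[of "2 - 2 * e"] distrib_right
        by linarith
      note this[folded j]
      moreover have "offline_bound (ls @ [1]) (V + e) (real (Suc k) * e)"
        using offline_bound_up(1)[OF off ls] unfolding j .
      ultimately show ?thesis using l k False
        by (intro exI[of _ "ls @ [1]"] exI[of _ "Suc k"] exI[of _ "V + e"]) auto
    qed
  qed
qed

lemma not_competitive:
  assumes N: "e = 1 / real N" "N > 0" and c: "c \<le> 2 - 2 * e"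
  obtains ls where "load_sequence 2 ls" "c * opt_cost 2 1 (vee e) ls < expectation (cost ls)"
proof -
  \<comment> \<open>The 5 outweighs the constant 3 of \<open>adversary\<close> and the bound 2 on
    the potential.\<close>
  obtain n where n: "5 < real n * (e ^ 3 / 8)"
    using ex_less_of_nat_mult[of "e ^ 3 / 8" 5] e_pos by auto
  obtain ls k V where ls: "loads ls" "ls \<noteq> []" and k: "k \<le> N"
    and off: "offline_bound ls V (real k * e)"
    and cost: "expectation (cost ls) + potential e (P ls) (real k * e)
      \<ge> (2 - 2 * e) * V + real n * (e ^ 3 / 8) - 3"
    using adversary[OF N] by blast
  obtain xs where xs: "feasible 2 ls xs" "schedule_cost 1 (vee e) ls xs \<le> V"
    using off by (auto simp: offline_bound_def)
  have opt: "0 \<le> opt_cost 2 1 (vee e) ls" "opt_cost 2 1 (vee e) ls \<le> V"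
    using opt_cost_nonneg[of 1 "vee e", OF _ vee_nonneg xs(1)]
      opt_cost_le[of 1 "vee e", OF _ vee_nonneg xs(1)] xs(2) e_pos by auto
  have "c * opt_cost 2 1 (vee e) ls \<le> (2 - 2 * e) * opt_cost 2 1 (vee e) ls"
    using c opt by (intro mult_right_mono) auto
  also have "\<dots> \<le> (2 - 2 * e) * V" using opt e_le by (intro mult_left_mono) auto
  finally have 1: "c * opt_cost 2 1 (vee e) ls \<le> (2 - 2 * e) * V" .
  have y: "0 \<le> real k * e" "real k * e \<le> 1" using k N by auto
  have "(1 - 2 * e) * max 0 (real k * e - P ls) \<le> 1 * 1"
    using e_pos e_le y P_bounds[OF ls] by (intro mult_mono) auto
  moreover have "(real k * e)\<^sup>2 \<le> 1" using y by (simp add: power_le_one)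
  moreover have "0 \<le> e * P ls" using e_pos P_bounds[OF ls] by simp
  ultimately have "potential e (P ls) (real k * e) \<le> 2" unfolding potential_def by linarith
  then show thesis using that[OF loads_load_sequence[OF ls(1)]] 1 n cost by linarith
qed

end

theorem theorem5p10:
  "\<not> (\<exists>(M :: nat \<Rightarrow> real \<Rightarrow> (real \<Rightarrow> real) \<Rightarrow> 'w measure)
       (A :: nat \<Rightarrow> real \<Rightarrow> (real \<Rightarrow> real) \<Rightarrow> 'w \<Rightarrow> real list \<Rightarrow> nat)
       (c :: real).
       c < 2 \<and> randomized_online_algorithm M A \<and> competitive_oblivious M A c)"
proof (intro notI, elim exE conjE)
  fix M :: "nat \<Rightarrow> real \<Rightarrow> (real \<Rightarrow> real) \<Rightarrow> 'w measure"
    and A :: "nat \<Rightarrow> real \<Rightarrow> (real \<Rightarrow> real) \<Rightarrow> 'w \<Rightarrow> real list \<Rightarrow> nat" and c :: real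
  assume c: "c < 2" and alg: "randomized_online_algorithm M A" and comp: "competitive_oblivious M A c"
  obtain n where n: "n > 0" "1 / real n < (2 - c) / 2"
    using c ex_inverse_of_nat_less[of "(2 - c) / 2"] by (auto simp: inverse_eq_divide)
  \<comment> \<open>The successor ensures \<open>N \<ge> 2\<close>, hence
    \<open>e \<le> 1 / 2\<close>.\<close>
  define N where "N = n + 1"
  define e where "e = 1 / real N"
  have N: "N > 0" "N \<ge> 2" using n by (auto simp: N_def)
  have e: "0 < e" "e \<le> 1 / 2" using N by (auto simp: e_def field_simps)
  have "e \<le> 1 / real n" using n by (simp add: e_def N_def field_simps)
  then have ce: "c \<le> 2 - 2 * e" using n by simp
  have model: "restricted_model 1 (vee e)"
    using e by (simp add: restricted_model_def convex_on_vee vee_nonneg)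
  interpret prob_space "M 2 1 (vee e)"
    using alg model by (auto simp: randomized_online_algorithm_def)
  interpret two_state_algorithm "M 2 1 (vee e)" "A 2 1 (vee e)" e
    using alg model e by unfold_locales (auto simp: randomized_online_algorithm_def)
  obtain ls where "load_sequence 2 ls" "c * opt_cost 2 1 (vee e) ls < expectation (cost ls)"
    using not_competitive[OF e_def N(1) ce] by blast
  then show False using comp model by (fastforce simp: competitive_oblivious_def)
qed

end
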